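(* Let $\Delta=-\sum_{i=1}^n\partial_{x_i}^2$ on $\mathbb{R}^n$. There exists a constant $C=C(n)>0$, independent of $t$, such that for every $t\ge1$, $$\big\|(1+\Delta)^{-n/2}e^{it\Delta}\big\|_{L^1(\mathbb{R}^n)\to L^{1,\infty}(\mathbb{R}^n)}\ge C\,t^{n/2}.$$
   Context: $(1+\Delta)^{-n/2}e^{it\Delta}$ is the Fourier multiplier operator with symbol $(1+|\xi|^2)^{-n/2}e^{it|\xi|^2}$. The weak $L^1$ quasi-norm is $\|g\|_{L^{1,\infty}(\mathbb{R}^n)}=\sup_{\lambda>0}\lambda\,|\{x\in\mathbb{R}^n:|g(x)|>\lambda\}|$, where $|E|$ denotes Lebesgue measure, and $\|T\|_{L^1\to L^{1,\infty}}$ is the supremum of $\|Tf\|_{L^{1,\infty}}$ over $f$ with $\|f\|_{L^1}=1$. *)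

theory Defs
  imports "HOL-Analysis.Analysis"
begin

definition fourier_transform :: "('a::euclidean_space \<Rightarrow> complex) \<Rightarrow> 'a \<Rightarrow> complex" where
  "fourier_transform f \<xi> = (LINT x|lborel. f x * cis (- (x \<bullet> \<xi>)))"

text \<open>
  The inverse Fourier transform on \<open>L\<^sup>2\<close>, as a relation between representatives of
  a.e.-classes: \<open>g\<close> is the limit in \<open>L\<^sup>2\<close>, as \<open>R\<close> tends to infinity, of the inverse Fourier
  integrals of \<open>h\<close> truncated to balls. By Plancherel, every \<open>h\<close> in \<open>L\<^sup>2\<close> has such a \<open>g\<close>,
  and it is unique up to null sets. The normalisation \<open>(2\<pi>)\<^sup>-\<^sup>n\<close> matches that of
  \<^const>\<open>fourier_transform\<close>, for which minus the sum of the second partial derivatives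
  has symbol \<open>|\<xi>|\<^sup>2\<close>.
\<close>

definition is_inverse_fourier_L2 ::
    "('a::euclidean_space \<Rightarrow> complex) \<Rightarrow> ('a \<Rightarrow> complex) \<Rightarrow> bool" where
  "is_inverse_fourier_L2 h g \<longleftrightarrow>
     h \<in> borel_measurable lborel \<and> integrable lborel (\<lambda>\<xi>. (norm (h \<xi>))\<^sup>2) \<and>
     g \<in> borel_measurable lborel \<and>
     ((\<lambda>R. \<integral>\<^sup>+ x. ennreal ((norm (g x -
          complex_of_real (1 / (2 * pi) ^ DIM('a)) *
            (LINT \<xi>:cball 0 R|lborel. h \<xi> * cis (x \<bullet> \<xi>))))\<^sup>2) \<partial>lborel)
       \<longlongrightarrow> 0) at_top"

text \<open>
  The Fourier multiplier operator with symbol \<open>m\<close>. For integrable \<open>f\<close> the transform of \<open>f\<close> is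
  bounded, so if \<open>m\<close> is in \<open>L\<^sup>2\<close>, the image of \<open>f\<close> is a well-defined \<open>L\<^sup>2\<close> function
  up to null sets; the choice operator only selects a Borel representative. Outside this
  situation the value may be arbitrary.
\<close>

definition fourier_multiplier ::
    "('a::euclidean_space \<Rightarrow> complex) \<Rightarrow> ('a \<Rightarrow> complex) \<Rightarrow> 'a \<Rightarrow> complex" where
  "fourier_multiplier m f =
     (SOME g. is_inverse_fourier_L2 (\<lambda>\<xi>. m \<xi> * fourier_transform f \<xi>) g)"

text \<open>
  The symbol of \<open>(1 + \<Delta>)\<^sup>-\<^sup>n\<^sup>/\<^sup>2 e\<^sup>i\<^sup>t\<^sup>\<Delta>\<close> with \<open>\<Delta>\<close> the nonnegative Laplacian. It is in \<open>L\<^sup>2\<close>,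
  because \<open>(1 + |\<xi>|\<^sup>2)\<^sup>-\<^sup>n\<close> is integrable in dimension \<open>n\<close>.
\<close>

definition schroedinger_symbol :: "real \<Rightarrow> 'a::euclidean_space \<Rightarrow> complex" where
  "schroedinger_symbol t \<xi> =
     complex_of_real ((1 + (norm \<xi>)\<^sup>2) powr (- (real DIM('a) / 2))) * cis (t * (norm \<xi>)\<^sup>2)"

definition weak_L1_norm :: "('a::euclidean_space \<Rightarrow> complex) \<Rightarrow> ennreal" where
  "weak_L1_norm g = (SUP l\<in>{0::real<..}. ennreal l * emeasure lborel {x. norm (g x) > l})"

definition L1_weak_L1_opnorm ::
    "(('a::euclidean_space \<Rightarrow> complex) \<Rightarrow> 'a \<Rightarrow> complex) \<Rightarrow> ennreal" where
  "L1_weak_L1_opnorm T =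
     (SUP f\<in>{f. integrable lborel f \<and> (LINT x|lborel. norm (f x)) = 1}. weak_L1_norm (T f))"

end

theory Submission
  imports Defs "HOL-Probability.Probability"
begin

text \<open>
  Apply the operator to the \<open>L\<^sup>1\<close>-normalised Gaussian \<open>f\<close> with transform \<open>exp (- A |\<xi>|\<^sup>2)\<close>, where
  \<open>A\<close> is large but independent of \<open>t\<close>. Then \<open>Tf = P + E\<close>, where \<open>P\<close> arises by replacing the
  factor \<open>(1 + |\<xi>|\<^sup>2) powr (- n / 2)\<close> of the symbol by \<open>1\<close>. The function \<open>P\<close> is a complex Gaussian:
  with \<open>D\<^sup>2 = A\<^sup>2 + t\<^sup>2\<close>, its modulus is at least a multiple of \<open>D powr (- n / 2)\<close> on the ball
  of radius \<open>D / sqrt A\<close>. By Bessel's inequality \<open>E\<close> is small in \<open>L\<^sup>2\<close>, since \<open>f\<close> lives on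
  frequencies of size \<open>1 / sqrt A\<close>, where that factor is close to \<open>1\<close>; so, by Chebyshev, it spoils
  the lower bound on at most half of the ball. Hence \<open>|Tf|\<close> exceeds a multiple of \<open>D powr (- n / 2)\<close>
  on a set of measure comparable to \<open>D\<^sup>n\<close>.
\<close>

section \<open>Fourier integrals of real Gaussians\<close>

lemma borel_measurable_cis [measurable]: "cis \<in> borel_measurable borel"
  by (rule borel_measurable_continuous_onI) (intro continuous_intros)

lemma borel_measurable_cnj [measurable]: "cnj \<in> borel_measurable borel"
  by (rule borel_measurable_continuous_onI) (intro continuous_intros)

text \<open>Up to scaling this is the characteristic function of the standard normal distribution,
  which is its own Fourier transform up to a constant.\<close>

lemma gaussian_fourier_real:
  fixes a s :: real
  assumes a: "a > 0"
  shows "has_bochner_integral lborel (\<lambda>x. complex_of_real (exp (- a * x\<^sup>2)) * cis (s * x))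
    (complex_of_real (sqrt (pi / a) * exp (- s\<^sup>2 / (4 * a))))"
proof -
  \<comment> \<open>The substitution \<open>y = c * x\<close> turns
    \<open>exp (- y\<^sup>2 / 2)\<close> into \<open>exp (- a * x\<^sup>2)\<close>; the frequency
    becomes \<open>s / c\<close> and the Jacobian contributes \<open>1 / c\<close>.\<close>
  define c where "c = sqrt (2 * a)"
  have c: "c > 0" "c\<^sup>2 = 2 * a" using a by (auto simp: c_def)
  have *: "complex_of_real (std_normal_density y) = complex_of_real (1 / sqrt (2 * pi)) * complex_of_real (exp (- y\<^sup>2 / 2))" for y
    by (simp add: std_normal_density_def)
  have int: "integrable lborel (\<lambda>y. complex_of_real (exp (- y\<^sup>2 / 2)) * cis (t * y))" for t :: real
  proof -
    have "integrable lborel (\<lambda>y::real. sqrt (2 * pi) * std_normal_density y)"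
      by simp
    then have "integrable lborel (\<lambda>y::real. exp (- y\<^sup>2 / 2))"
      by (simp add: std_normal_density_def)
    then show ?thesis
      by (rule Bochner_Integration.integrable_bound) (auto simp: norm_mult)
  qed
  have val: "(LINT y|lborel. complex_of_real (exp (- y\<^sup>2 / 2)) * cis (t * y)) = sqrt (2 * pi) * exp (- t\<^sup>2 / 2)"
    for t :: real
  proof -
    have "complex_of_real (exp (- t\<^sup>2 / 2)) = char std_normal_distribution t"
      by (simp add: char_std_normal_distribution)
    also have "\<dots> = (LINT y|lborel. std_normal_density y *\<^sub>R iexp (t * y))"
      unfolding char_def by (subst integral_density) auto
    also have "\<dots> = (LINT y|lborel. complex_of_real (1 / sqrt (2 * pi)) * (complex_of_real (exp (- y\<^sup>2 / 2)) * cis (t * y)))"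
      by (simp add: scaleR_conv_of_real * cis_conv_exp mult.assoc)
    also have "\<dots> = complex_of_real (1 / sqrt (2 * pi)) * (LINT y|lborel. (complex_of_real (exp (- y\<^sup>2 / 2)) * cis (t * y)))"
      by simp
    finally show ?thesis by (simp add: field_simps)
  qed
  have "has_bochner_integral lborel (\<lambda>y. complex_of_real (exp (- y\<^sup>2 / 2)) * cis (s / c * y))
     (complex_of_real (sqrt (2 * pi) * exp (- (s / c)\<^sup>2 / 2)))"
    using int[of "s / c"] val[of "s / c"] unfolding has_bochner_integral_iff by blast
  then have "has_bochner_integral lborel (\<lambda>y. complex_of_real (exp (- (0 + c * y)\<^sup>2 / 2)) * cis (s / c * (0 + c * y)))
     (complex_of_real (sqrt (2 * pi) * exp (- (s / c)\<^sup>2 / 2)) /\<^sub>R \<bar>c\<bar>)"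
    by (subst (asm) lborel_has_bochner_integral_real_affine_iff[where c=c and t=0]) (use c in auto)
  moreover have "(complex_of_real (sqrt (2 * pi) * exp (- (s / c)\<^sup>2 / 2)) /\<^sub>R \<bar>c\<bar>)
     = (complex_of_real (sqrt (pi / a) * exp (- s\<^sup>2 / (4 * a))))"
  proof -
    have "sqrt (2 * pi) / c = sqrt (pi / a)"
      using a unfolding c_def by (simp add: real_sqrt_divide [symmetric])
    moreover have "(s / c)\<^sup>2 / 2 = s\<^sup>2 / (4 * a)"
      by (simp add: power_divide c)
    ultimately have "sqrt (2 * pi) * exp (- (s / c)\<^sup>2 / 2) / \<bar>c\<bar> = sqrt (pi / a) * exp (- s\<^sup>2 / (4 * a))"
      using c(1) by (metis (no_types, lifting) abs_of_pos minus_divide_left times_divide_eq_left)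
    then show ?thesis
      by (metis divideR_right divide_inverse mult.commute of_real_mult scaleR_conv_of_real)
  qed
  moreover have "complex_of_real (exp (- (0 + c * y)\<^sup>2 / 2)) * cis (s / c * (0 + c * y)) =
     complex_of_real (exp (- a * y\<^sup>2)) * cis (s * y)" for y
    using c by (simp add: power_mult_distrib)
  ultimately show ?thesis by simp
qed

text \<open>\<open>lborel\<close> on a Euclidean space is the image of a product of one-dimensional
  Lebesgue measures under the map that assembles coordinates along \<open>Basis\<close>, so the
  integral of a product of functions of single coordinates splits.\<close>

lemma has_bochner_integral_lborel_prod:
  fixes f :: "'a::euclidean_space \<Rightarrow> real \<Rightarrow> 'b::{real_normed_field,banach,second_countable_topology}"
  assumes "\<And>b. b \<in> Basis \<Longrightarrow> has_bochner_integral lborel (f b) (I b)"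
  shows "has_bochner_integral lborel (\<lambda>x. \<Prod>b\<in>Basis. f b (x \<bullet> b)) (\<Prod>b\<in>Basis. I b)"
proof -
  interpret product_sigma_finite "\<lambda>_::'a. lborel :: real measure"
    by standard
  have m[measurable]: "b \<in> Basis \<Longrightarrow> f b \<in> borel_measurable borel" for b
    using borel_measurable_has_bochner_integral[OF assms] by simp
  have "has_bochner_integral (\<Pi>\<^sub>M b\<in>(Basis::'a set). lborel) (\<lambda>x. \<Prod>b\<in>Basis. f b (x b)) (\<Prod>b\<in>Basis. I b)"
    using assms by (auto simp: has_bochner_integral_iff product_integrable_prod product_integral_prod)
  then show ?thesis
    by (subst lborel_eq, intro has_bochner_integral_distr) (simp_all add: inner_sum_left_Basis)
qed

lemma cis_sum: "finite A \<Longrightarrow> cis (\<Sum>x\<in>A. f x) = (\<Prod>x\<in>A. cis (f x))"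
  by (induction A rule: finite_induct) (simp_all flip: cis_mult)

text \<open>The Gaussian and the character both factor over the coordinates, which reduces the claim
  to dimension one. The power is written with \<open>powr\<close> because \<open>DIM('a) / 2\<close>
  need not be an integer.\<close>

lemma gaussian_fourier:
  fixes x :: "'a::euclidean_space"
  assumes a: "a > 0"
  shows "has_bochner_integral lborel (\<lambda>\<xi>. complex_of_real (exp (- a * (norm \<xi>)\<^sup>2)) * cis (x \<bullet> \<xi>))
    (complex_of_real ((pi / a) powr (DIM('a) / 2) * exp (- (norm x)\<^sup>2 / (4 * a))))"
proof -
  have sq: "(norm y)\<^sup>2 = (\<Sum>b\<in>Basis. (y \<bullet> b)\<^sup>2)" for y :: 'a
    by (subst power2_norm_eq_inner, subst euclidean_inner) (simp add: power2_eq_square)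
  have "has_bochner_integral lborel
      (\<lambda>\<xi>::'a. \<Prod>b\<in>Basis. complex_of_real (exp (- a * (\<xi> \<bullet> b)\<^sup>2)) * cis ((x \<bullet> b) * (\<xi> \<bullet> b)))
      (\<Prod>b\<in>(Basis::'a set). complex_of_real (sqrt (pi / a) * exp (- (x \<bullet> b)\<^sup>2 / (4 * a))))"
    by (rule has_bochner_integral_lborel_prod) (rule gaussian_fourier_real[OF a])
  moreover have "(\<Prod>b\<in>Basis. complex_of_real (exp (- a * (\<xi> \<bullet> b)\<^sup>2)) * cis ((x \<bullet> b) * (\<xi> \<bullet> b)))
      = complex_of_real (exp (- a * (norm \<xi>)\<^sup>2)) * cis (x \<bullet> \<xi>)" for \<xi> :: 'a
  proof -
    have "cis (x \<bullet> \<xi>) = (\<Prod>b\<in>Basis. cis ((x \<bullet> b) * (\<xi> \<bullet> b)))"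
      by (subst euclidean_inner) (simp add: cis_sum)
    moreover have "exp (- a * (norm \<xi>)\<^sup>2) = (\<Prod>b\<in>Basis. exp (- a * (\<xi> \<bullet> b)\<^sup>2))"
      unfolding sq sum_distrib_left by (rule exp_sum) simp
    ultimately show ?thesis
      by (simp only: prod.distrib of_real_prod)
  qed
  moreover have "sqrt (pi / a) ^ DIM('a) = (pi / a) powr (DIM('a) / 2)"
  proof -
    have "sqrt (pi / a) ^ DIM('a) = ((pi / a) powr (1 / 2)) powr real DIM('a)"
      using a by (subst powr_realpow) (auto simp: powr_half_sqrt)
    then show ?thesis by (simp add: powr_powr)
  qed
  then have "(\<Prod>b\<in>(Basis::'a set). sqrt (pi / a) * exp (- (x \<bullet> b)\<^sup>2 / (4 * a)))
      = (pi / a) powr (DIM('a) / 2) * exp (- (norm x)\<^sup>2 / (4 * a))"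
    unfolding sq sum_divide_distrib sum_negf [symmetric]
    by (simp only: prod.distrib exp_sum[OF finite_Basis] prod_constant)
  then have "(\<Prod>b\<in>(Basis::'a set). complex_of_real (sqrt (pi / a) * exp (- (x \<bullet> b)\<^sup>2 / (4 * a))))
      = complex_of_real ((pi / a) powr (DIM('a) / 2) * exp (- (norm x)\<^sup>2 / (4 * a)))"
    by (simp only: of_real_prod [symmetric])
  ultimately show ?thesis by simp
qed

lemma gaussian_integral:
  assumes a: "a > 0"
  shows "has_bochner_integral lborel (\<lambda>\<xi>::'a::euclidean_space. exp (- a * (norm \<xi>)\<^sup>2))
    ((pi / a) powr (DIM('a) / 2))"
  using has_bochner_integral_bounded_linear[OF bounded_linear_Re gaussian_fourier[OF a, of "0::'a"]]
  by simp

section \<open>Translation invariance and elementary bounds for Fourier integrals\<close>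

lemma has_bochner_integral_lborel_translate:
  fixes f :: "'a::euclidean_space \<Rightarrow> 'b::{banach,second_countable_topology}"
  assumes "has_bochner_integral lborel f I"
  shows "has_bochner_integral lborel (\<lambda>x. f (c + x)) I"
proof -
  have f: "f \<in> borel_measurable borel" and c: "(+) c \<in> measurable lborel borel"
    using borel_measurable_has_bochner_integral[OF assms] by simp_all
  have "has_bochner_integral (distr lborel borel ((+) c)) f I"
    using assms by (simp add: lborel_distr_plus)
  then show ?thesis
    by (simp only: has_bochner_integral_iff integrable_distr_eq[OF c f] integral_distr[OF c f])
qed

lemma integral_lborel_translate:
  fixes f :: "'a::euclidean_space \<Rightarrow> 'b::{banach,second_countable_topology}"
  assumes [measurable]: "f \<in> borel_measurable borel"
  shows "(LINT x|lborel. f (c + x)) = (LINT x|lborel. f x)"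
  using integral_distr[of "(+) c" lborel borel f] by (simp add: lborel_distr_plus)

lemma gaussian_nn_integral:
  fixes c :: "'a::euclidean_space"
  assumes a: "a > 0"
  shows "(\<integral>\<^sup>+\<xi>. ennreal (exp (- a * (norm (\<xi> - c))\<^sup>2)) \<partial>lborel) = ennreal ((pi / a) powr (DIM('a) / 2))"
proof -
  have "has_bochner_integral lborel (\<lambda>\<xi>. exp (- a * (norm (- c + \<xi>))\<^sup>2)) ((pi / a) powr (DIM('a) / 2))"
    by (rule has_bochner_integral_lborel_translate[OF gaussian_integral[OF a]])
  then show ?thesis
    by (subst nn_integral_eq_integral) (auto simp: has_bochner_integral_iff)
qed

lemma borel_measurable_fourier_integral [measurable]:
  fixes h :: "'a::euclidean_space \<Rightarrow> complex"
  assumes [measurable]: "h \<in> borel_measurable borel"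
  shows "(\<lambda>x. LINT \<xi>|lborel. h \<xi> * cis (x \<bullet> \<xi>)) \<in> borel_measurable borel"
proof -
  have "(\<lambda>x. LINT \<xi>|lborel. h \<xi> * cis (x \<bullet> \<xi>)) \<in> borel_measurable lborel"
    by (rule lborel.borel_measurable_lebesgue_integral) measurable
  then show ?thesis by simp
qed

lemma norm_fourier_integral_le:
  "norm (LINT \<xi>|lborel. h \<xi> * cis (x \<bullet> \<xi>)) \<le> (LINT \<xi>|lborel. norm (h \<xi>))"
  by (rule order_trans[OF integral_norm_bound]) (simp add: norm_mult)

lemma integrable_mult_cis:
  fixes h :: "'a::euclidean_space \<Rightarrow> complex"
  assumes h: "integrable lborel h"
  shows "integrable lborel (\<lambda>\<xi>. h \<xi> * cis (x \<bullet> \<xi>))"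
proof -
  have [measurable]: "h \<in> borel_measurable borel"
    using borel_measurable_integrable[OF h] by simp
  show ?thesis
    by (rule Bochner_Integration.integrable_bound[OF h]) (auto simp: norm_mult)
qed

text \<open>For a non-integrable \<open>f\<close> the Bochner integral is 0 by convention, so the
  bound is trivial in that case. This permits absolute values to be taken under an integral without
  checking integrability first.\<close>

lemma norm_integral_le_nn_integral:
  fixes f :: "'a \<Rightarrow> 'b::{banach,second_countable_topology}"
  shows "ennreal (norm (LINT x|M. f x)) \<le> (\<integral>\<^sup>+x. ennreal (norm (f x)) \<partial>M)"
  by (cases "integrable M f") (auto simp: integral_norm_bound_ennreal not_integrable_integral_eq)

section \<open>Bessel's inequality for Fourier integrals\<close>

text \<open>
  By Fubini the left-hand side is \<open>\<integral>\<integral> h(\<xi>) cnj (h(\<eta>)) K(\<xi> - \<eta>)\<close> for a Gaussian \<open>K \<ge> 0\<close> of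
  total mass \<open>(2\<pi>)\<^sup>n\<close> whatever \<open>\<epsilon>\<close> is; conclude with \<open>2ab \<le> a\<^sup>2 + b\<^sup>2\<close>.
\<close>

lemma gaussian_weighted_fourier_bound:
  fixes h :: "'a::euclidean_space \<Rightarrow> complex"
  assumes h: "integrable lborel h" and h2: "integrable lborel (\<lambda>\<xi>. (norm (h \<xi>))\<^sup>2)"
    and e: "\<epsilon> > 0"
  shows "(\<integral>\<^sup>+x. ennreal (exp (- \<epsilon> * (norm x)\<^sup>2) * (norm (LINT \<xi>|lborel. h \<xi> * cis (x \<bullet> \<xi>)))\<^sup>2) \<partial>lborel)
    \<le> ennreal ((2 * pi) ^ DIM('a) * (LINT \<xi>|lborel. (norm (h \<xi>))\<^sup>2))"
proof -
  have hm[measurable]: "h \<in> borel_measurable borel"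
    using borel_measurable_integrable[OF h] by simp
  define H where "H = (\<lambda>x. LINT \<xi>|lborel. h \<xi> * cis (x \<bullet> \<xi>))"
  define N where "N = (LINT \<xi>|lborel. norm (h \<xi>))"
  define w where "w = (\<lambda>x::'a. exp (- \<epsilon> * (norm x)\<^sup>2))"
  define K where "K = (\<lambda>u::'a. (pi / \<epsilon>) powr (DIM('a) / 2) * exp (- (norm u)\<^sup>2 / (4 * \<epsilon>)))"
  have [measurable]: "H \<in> borel_measurable borel" "w \<in> borel_measurable borel" "K \<in> borel_measurable borel"
    unfolding H_def w_def K_def by measurable
  have HN: "norm (H x) \<le> N" for x
    unfolding H_def N_def by (rule norm_fourier_integral_le)
  have wint: "integrable lborel w"
    using gaussian_integral[OF e, where 'a='a] by (simp add: w_def has_bochner_integral_iff)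
  have w0: "w x > 0" for x by (simp add: w_def)
  have K0: "K u \<ge> 0" for u by (simp add: K_def)
  \<comment> \<open>The Gaussian weight \<open>w\<close> supplies the integrability in
    \<open>x\<close>: the function \<open>H\<close> itself is only known to be bounded by
    \<open>N\<close>.\<close>
  have int1: "integrable (lborel \<Otimes>\<^sub>M lborel) (\<lambda>(x, \<xi>). of_real (w x) * (h \<xi> * cis (x \<bullet> \<xi>)) * cnj (H x))"
  proof (rule lborel_pair.Fubini_integrable)
    show "AE x in lborel. integrable lborel (\<lambda>\<xi>. case (x, \<xi>) of (x, \<xi>) \<Rightarrow> of_real (w x) * (h \<xi> * cis (x \<bullet> \<xi>)) * cnj (H x))"
      using integrable_mult_cis[OF h] by (intro AE_I2) auto
    have "integrable lborel (\<lambda>x. w x * norm (H x) * N)"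
      by (intro integrable_mult_left Bochner_Integration.integrable_bound[OF integrable_mult_left[OF wint, of N]])
        (auto simp: abs_mult intro!: mult_left_mono order_trans[OF HN abs_ge_self])
    then show "integrable lborel (\<lambda>x. LINT \<xi>|lborel. norm (case (x, \<xi>) of (x, \<xi>) \<Rightarrow> of_real (w x) * (h \<xi> * cis (x \<bullet> \<xi>)) * cnj (H x)))"
      using w0 by (simp add: norm_mult abs_of_pos N_def mult_ac)
  qed measurable
  have int2: "integrable (lborel \<Otimes>\<^sub>M lborel) (\<lambda>(x, \<eta>). of_real (w x) * cis (x \<bullet> \<xi>) * cnj (h \<eta> * cis (x \<bullet> \<eta>)))" for \<xi>
  proof (rule lborel_pair.Fubini_integrable)
    show "AE x in lborel. integrable lborel (\<lambda>\<eta>. case (x, \<eta>) of (x, \<eta>) \<Rightarrow> of_real (w x) * cis (x \<bullet> \<xi>) * cnj (h \<eta> * cis (x \<bullet> \<eta>)))"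
      using integrable_mult_cis[OF h] by (intro AE_I2) (auto simp del: complex_cnj_mult)
    have "integrable lborel (\<lambda>x. w x * N)"
      using wint by simp
    then show "integrable lborel (\<lambda>x. LINT \<eta>|lborel. norm (case (x, \<eta>) of (x, \<eta>) \<Rightarrow> of_real (w x) * cis (x \<bullet> \<xi>) * cnj (h \<eta> * cis (x \<bullet> \<eta>))))"
      using w0 by (simp add: norm_mult abs_of_pos N_def)
  qed measurable
  \<comment> \<open>Exchanging the integrals leaves the Fourier integral of the weight
    \<open>w\<close> at frequency \<open>\<xi> - \<eta>\<close>, and this is
    \<open>K\<close>.\<close>
  have inner: "(LINT x|lborel. of_real (w x) * cis (x \<bullet> \<xi>) * cnj (H x)) = (LINT \<eta>|lborel. cnj (h \<eta>) * of_real (K (\<xi> - \<eta>)))" for \<xi>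
  proof -
    have "(LINT x|lborel. of_real (w x) * cis (x \<bullet> \<xi>) * cnj (H x)) =
       (LINT x|lborel. (LINT \<eta>|lborel. of_real (w x) * cis (x \<bullet> \<xi>) * cnj (h \<eta> * cis (x \<bullet> \<eta>))))"
      unfolding H_def by (simp del: complex_cnj_mult flip: integral_cnj)
    also have "\<dots> = (LINT \<eta>|lborel. (LINT x|lborel. of_real (w x) * cis (x \<bullet> \<xi>) * cnj (h \<eta> * cis (x \<bullet> \<eta>))))"
      using lborel_pair.Fubini_integral[OF int2] by simp
    also have "\<dots> = (LINT \<eta>|lborel. cnj (h \<eta>) * (LINT x|lborel. of_real (w x) * cis ((\<xi> - \<eta>) \<bullet> x)))"
    proof (intro Bochner_Integration.integral_cong refl)
      fix \<eta>
      have "of_real (w x) * cis (x \<bullet> \<xi>) * cnj (h \<eta> * cis (x \<bullet> \<eta>)) = cnj (h \<eta>) * (of_real (w x) * cis ((\<xi> - \<eta>) \<bullet> x))" for x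
      proof -
        have "cis ((\<xi> - \<eta>) \<bullet> x) = cis (x \<bullet> \<xi>) * cnj (cis (x \<bullet> \<eta>))"
          by (simp add: inner_diff_left inner_commute[of x] cis_cnj cis_mult)
        then show ?thesis by simp
      qed
      then show "(LINT x|lborel. of_real (w x) * cis (x \<bullet> \<xi>) * cnj (h \<eta> * cis (x \<bullet> \<eta>))) =
         cnj (h \<eta>) * (LINT x|lborel. of_real (w x) * cis ((\<xi> - \<eta>) \<bullet> x))"
        by (simp only: integral_mult_right_zero)
    qed
    also have "\<dots> = (LINT \<eta>|lborel. cnj (h \<eta>) * of_real (K (\<xi> - \<eta>)))"
      unfolding w_def K_def using gaussian_fourier[OF e, where 'a='a]
      by (simp only: has_bochner_integral_iff)
    finally show ?thesis .
  qed
  \<comment> \<open>The height \<open>(pi / \<epsilon>) powr (n / 2)\<close> and the volume factor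
    \<open>(4 * pi * \<epsilon>) powr (n / 2)\<close> multiply to \<open>(2 * pi) ^ n\<close>, where
    \<open>n = DIM('a)\<close>: the width \<epsilon> cancels.\<close>
  have Kint: "(\<integral>\<^sup>+u. ennreal (K (u - c)) \<partial>lborel) = ennreal ((2 * pi) ^ DIM('a))" for c
  proof -
    have e4: "1 / (4 * \<epsilon>) > 0" using e by simp
    have "(\<integral>\<^sup>+u. ennreal (K (u - c)) \<partial>lborel) =
       (\<integral>\<^sup>+u. ennreal ((pi / \<epsilon>) powr (DIM('a) / 2)) * ennreal (exp (- (1 / (4 * \<epsilon>)) * (norm (u - c))\<^sup>2)) \<partial>lborel)"
      by (simp add: K_def ennreal_mult')
    also have "\<dots> = ennreal ((pi / \<epsilon>) powr (DIM('a) / 2) * (pi / (1 / (4 * \<epsilon>))) powr (DIM('a) / 2))"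
      by (subst nn_integral_cmult, measurable, subst gaussian_nn_integral[OF e4], rule ennreal_mult' [symmetric])
        simp
    also have "(pi / \<epsilon>) powr (DIM('a) / 2) * (pi / (1 / (4 * \<epsilon>))) powr (DIM('a) / 2) = ((2 * pi) powr 2) powr (DIM('a) / 2)"
      using e by (subst powr_mult [symmetric]) (auto simp: power2_eq_square mult_ac)
    also have "\<dots> = (2 * pi) ^ DIM('a)"
      by (subst powr_powr) (simp add: powr_realpow)
    finally show ?thesis .
  qed
  have Ksym: "K (\<xi> - \<eta>) = K (\<eta> - \<xi>)" for \<xi> \<eta>
    by (simp add: K_def norm_minus_commute)
  have Kint': "(\<integral>\<^sup>+u. ennreal (K (c - u)) \<partial>lborel) = ennreal ((2 * pi) ^ DIM('a))" for c
    unfolding Ksym[of c] by (rule Kint)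
  define I where "I = (\<integral>\<^sup>+\<xi>. ennreal ((norm (h \<xi>))\<^sup>2) \<partial>lborel)"
  \<comment> \<open>In each of these two double integrals \<open>K\<close> is integrated in the
    variable on which \<open>h\<close> does not depend, so only the total mass of \<open>K\<close>
    enters. The second one first needs the order of integration reversed.\<close>
  have half: "(\<integral>\<^sup>+\<xi>. (\<integral>\<^sup>+\<eta>. ennreal ((norm (h \<xi>))\<^sup>2) * ennreal (K (\<eta> - \<xi>)) \<partial>lborel) \<partial>lborel) = I * ennreal ((2 * pi) ^ DIM('a))"
    by (simp add: nn_integral_cmult nn_integral_multc Kint I_def)
  have half': "(\<integral>\<^sup>+\<xi>. (\<integral>\<^sup>+\<eta>. ennreal ((norm (h \<eta>))\<^sup>2) * ennreal (K (\<eta> - \<xi>)) \<partial>lborel) \<partial>lborel) = I * ennreal ((2 * pi) ^ DIM('a))"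
    by (subst lborel_pair.Fubini') (simp_all add: nn_integral_cmult nn_integral_multc Kint' I_def)
  have wH: "integrable lborel (\<lambda>x. w x * (norm (H x))\<^sup>2)"
    by (rule Bochner_Integration.integrable_bound[OF integrable_mult_left[OF wint, of "N\<^sup>2"]])
      (use HN w0 in \<open>auto simp: abs_mult intro!: mult_left_mono power_mono\<close>)
  have "(\<integral>\<^sup>+x. ennreal (w x * (norm (H x))\<^sup>2) \<partial>lborel) = ennreal (LINT x|lborel. w x * (norm (H x))\<^sup>2)"
    by (rule nn_integral_eq_integral[OF wH]) (simp add: w_def)
  \<comment> \<open>The nonnegative real number is regarded as a complex one, so that the square can
    be expanded as \<open>H x * cnj (H x)\<close>; the norm is kept outside until the triangle
    inequality is applied to the outer integral.\<close>
  also have "\<dots> \<le> ennreal (norm (complex_of_real (LINT x|lborel. w x * (norm (H x))\<^sup>2)))"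
    by (rule ennreal_leI) simp
  also have "complex_of_real (LINT x|lborel. w x * (norm (H x))\<^sup>2) = (LINT x|lborel. of_real (w x) * (H x * cnj (H x)))"
    by (simp only: integral_complex_of_real [symmetric] of_real_mult complex_norm_square)
  also have "\<dots> = (LINT x|lborel. (LINT \<xi>|lborel. of_real (w x) * (h \<xi> * cis (x \<bullet> \<xi>)) * cnj (H x)))"
    by (simp only: integral_mult_left_zero integral_mult_right_zero) (simp only: H_def mult.assoc)
  also have "\<dots> = (LINT \<xi>|lborel. (LINT x|lborel. of_real (w x) * (h \<xi> * cis (x \<bullet> \<xi>)) * cnj (H x)))"
    using lborel_pair.Fubini_integral[OF int1] by simp
  also have "\<dots> = (LINT \<xi>|lborel. h \<xi> * (LINT x|lborel. of_real (w x) * cis (x \<bullet> \<xi>) * cnj (H x)))"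
    by (simp only: integral_mult_right_zero [symmetric] mult_ac)
  also have "\<dots> = (LINT \<xi>|lborel. h \<xi> * (LINT \<eta>|lborel. cnj (h \<eta>) * of_real (K (\<xi> - \<eta>))))"
    by (simp only: inner)
  also have "ennreal (norm \<dots>) \<le> (\<integral>\<^sup>+\<xi>. ennreal (norm (h \<xi> * (LINT \<eta>|lborel. cnj (h \<eta>) * of_real (K (\<xi> - \<eta>))))) \<partial>lborel)"
    by (rule norm_integral_le_nn_integral)
  also have "\<dots> \<le> (\<integral>\<^sup>+\<xi>. (\<integral>\<^sup>+\<eta>. ennreal (norm (h \<xi>) * norm (h \<eta>) * K (\<eta> - \<xi>)) \<partial>lborel) \<partial>lborel)"
  proof (rule nn_integral_mono)
    fix \<xi>
    have "ennreal (norm (h \<xi> * (LINT \<eta>|lborel. cnj (h \<eta>) * of_real (K (\<xi> - \<eta>)))))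
       = ennreal (norm (h \<xi>)) * ennreal (norm (LINT \<eta>|lborel. cnj (h \<eta>) * of_real (K (\<xi> - \<eta>))))"
      by (simp add: norm_mult ennreal_mult')
    also have "\<dots> \<le> ennreal (norm (h \<xi>)) * (\<integral>\<^sup>+\<eta>. ennreal (norm (cnj (h \<eta>) * of_real (K (\<xi> - \<eta>)))) \<partial>lborel)"
      by (intro mult_left_mono norm_integral_le_nn_integral) simp
    also have "\<dots> = (\<integral>\<^sup>+\<eta>. ennreal (norm (h \<xi>) * norm (h \<eta>) * K (\<eta> - \<xi>)) \<partial>lborel)"
      by (subst nn_integral_cmult [symmetric])
        (auto simp: norm_mult K0 Ksym[of \<xi>] ennreal_mult' mult.assoc)
    finally show "ennreal (norm (h \<xi> * (LINT \<eta>|lborel. cnj (h \<eta>) * of_real (K (\<xi> - \<eta>)))))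
       \<le> (\<integral>\<^sup>+\<eta>. ennreal (norm (h \<xi>) * norm (h \<eta>) * K (\<eta> - \<xi>)) \<partial>lborel)" .
  qed
  also have "\<dots> \<le> (\<integral>\<^sup>+\<xi>. (\<integral>\<^sup>+\<eta>. ennreal (1/2) * (ennreal ((norm (h \<xi>))\<^sup>2) * ennreal (K (\<eta> - \<xi>))
       + ennreal ((norm (h \<eta>))\<^sup>2) * ennreal (K (\<eta> - \<xi>))) \<partial>lborel) \<partial>lborel)"
  proof (intro nn_integral_mono)
    fix \<xi> \<eta>
    have "norm (h \<xi>) * norm (h \<eta>) \<le> 1/2 * ((norm (h \<xi>))\<^sup>2 + (norm (h \<eta>))\<^sup>2)"
      using sum_squares_bound[of "norm (h \<xi>)" "norm (h \<eta>)"] by simp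
    from mult_right_mono[OF this K0[of "\<eta> - \<xi>"]]
    have "norm (h \<xi>) * norm (h \<eta>) * K (\<eta> - \<xi>)
      \<le> 1/2 * ((norm (h \<xi>))\<^sup>2 * K (\<eta> - \<xi>) + (norm (h \<eta>))\<^sup>2 * K (\<eta> - \<xi>))"
      by (simp add: algebra_simps)
    then have "ennreal (norm (h \<xi>) * norm (h \<eta>) * K (\<eta> - \<xi>))
      \<le> ennreal (1/2 * ((norm (h \<xi>))\<^sup>2 * K (\<eta> - \<xi>) + (norm (h \<eta>))\<^sup>2 * K (\<eta> - \<xi>)))"
      by (rule ennreal_leI)
    also have "\<dots> = ennreal (1/2) * (ennreal ((norm (h \<xi>))\<^sup>2) * ennreal (K (\<eta> - \<xi>))
       + ennreal ((norm (h \<eta>))\<^sup>2) * ennreal (K (\<eta> - \<xi>)))"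
      by (simp only: ennreal_mult' ennreal_plus K0 mult_nonneg_nonneg zero_le_power2 norm_ge_zero)
    finally show "ennreal (norm (h \<xi>) * norm (h \<eta>) * K (\<eta> - \<xi>)) \<le> ennreal (1/2) * (ennreal ((norm (h \<xi>))\<^sup>2) * ennreal (K (\<eta> - \<xi>))
       + ennreal ((norm (h \<eta>))\<^sup>2) * ennreal (K (\<eta> - \<xi>)))" .
  qed
  also have "\<dots> = ennreal (1/2) * ((\<integral>\<^sup>+\<xi>. (\<integral>\<^sup>+\<eta>. ennreal ((norm (h \<xi>))\<^sup>2) * ennreal (K (\<eta> - \<xi>)) \<partial>lborel) \<partial>lborel)
      + (\<integral>\<^sup>+\<xi>. (\<integral>\<^sup>+\<eta>. ennreal ((norm (h \<eta>))\<^sup>2) * ennreal (K (\<eta> - \<xi>)) \<partial>lborel) \<partial>lborel))"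
    by (simp add: nn_integral_add nn_integral_cmult)
  also have "\<dots> = (ennreal (1/2) + ennreal (1/2)) * (I * ennreal ((2 * pi) ^ DIM('a)))"
    unfolding half half' by (simp add: distrib_left distrib_right)
  also have "ennreal (1/2) + ennreal (1/2) = 1"
    by (subst ennreal_plus [symmetric]) simp_all
  also have "1 * (I * ennreal ((2 * pi) ^ DIM('a))) = ennreal ((2 * pi) ^ DIM('a) * (LINT \<xi>|lborel. (norm (h \<xi>))\<^sup>2))"
    unfolding I_def by (subst nn_integral_eq_integral[OF h2]) (simp_all add: ennreal_mult' mult.commute)
  finally show ?thesis
    unfolding w_def H_def .
qed

text \<open>The bound with Gaussian weight is uniform in \<epsilon>, so Fatou's lemma removes the
  weight as \<epsilon> tends to 0. This is the inequality half of Plancherel's theorem, and it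
  suffices for all the estimates in L2 that follow.\<close>

lemma fourier_bessel_inequality:
  fixes h :: "'a::euclidean_space \<Rightarrow> complex"
  assumes h: "integrable lborel h" and h2: "integrable lborel (\<lambda>\<xi>. (norm (h \<xi>))\<^sup>2)"
  shows "(\<integral>\<^sup>+x. ennreal ((norm (LINT \<xi>|lborel. h \<xi> * cis (x \<bullet> \<xi>)))\<^sup>2) \<partial>lborel)
    \<le> ennreal ((2 * pi) ^ DIM('a) * (LINT \<xi>|lborel. (norm (h \<xi>))\<^sup>2))"
proof -
  have hm[measurable]: "h \<in> borel_measurable borel"
    using borel_measurable_integrable[OF h] by simp
  define H where "H = (\<lambda>x. LINT \<xi>|lborel. h \<xi> * cis (x \<bullet> \<xi>))"
  have [measurable]: "H \<in> borel_measurable borel"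
    unfolding H_def by measurable
  define u where "u = (\<lambda>k x. ennreal (exp (- inverse (real (Suc k)) * (norm x)\<^sup>2) * (norm (H x))\<^sup>2))"
  have "liminf (\<lambda>k. u k x) = ennreal ((norm (H x))\<^sup>2)" for x
  proof (rule lim_imp_Liminf)
    have "(\<lambda>k. exp (- inverse (real (Suc k)) * (norm x)\<^sup>2) * (norm (H x))\<^sup>2)
        \<longlonglongrightarrow> exp (- 0 * (norm x)\<^sup>2) * (norm (H x))\<^sup>2"
      by (intro tendsto_intros LIMSEQ_inverse_real_of_nat)
    then show "(\<lambda>k. u k x) \<longlonglongrightarrow> ennreal ((norm (H x))\<^sup>2)"
      unfolding u_def by (intro tendsto_ennrealI) simp
  qed simp
  then have "(\<integral>\<^sup>+x. ennreal ((norm (H x))\<^sup>2) \<partial>lborel) = (\<integral>\<^sup>+x. liminf (\<lambda>k. u k x) \<partial>lborel)"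
    by simp
  also have "\<dots> \<le> liminf (\<lambda>k. \<integral>\<^sup>+x. u k x \<partial>lborel)"
    by (rule nn_integral_liminf) (simp add: u_def)
  also have "\<dots> \<le> liminf (\<lambda>k. ennreal ((2 * pi) ^ DIM('a) * (LINT \<xi>|lborel. (norm (h \<xi>))\<^sup>2)))"
    unfolding u_def H_def
    by (intro Liminf_mono always_eventually allI gaussian_weighted_fourier_bound[OF h h2]) simp
  also have "\<dots> = ennreal ((2 * pi) ^ DIM('a) * (LINT \<xi>|lborel. (norm (h \<xi>))\<^sup>2))"
    by (rule Liminf_const) simp
  finally show ?thesis unfolding H_def .
qed

section \<open>The modulus of the Fourier integral of a complex Gaussian\<close>

text \<open>
  Expanding the square as a double integral over \<open>\<eta>\<close> and \<open>\<eta> + u\<close> and centring \<open>\<eta>\<close> at \<open>- u / 2\<close>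
  leaves only real Gaussians, so no complex square root and no contour shift is needed.
\<close>

lemma complex_gaussian_fourier_norm:
  fixes x :: "'a::euclidean_space"
  assumes A: "A > 0"
  shows "(norm (LINT \<xi>|lborel. complex_of_real (exp (- A * (norm \<xi>)\<^sup>2)) * cis (t * (norm \<xi>)\<^sup>2) * cis (x \<bullet> \<xi>)))\<^sup>2
    = (pi\<^sup>2 / (A\<^sup>2 + t\<^sup>2)) powr (DIM('a) / 2) * exp (- A * (norm x)\<^sup>2 / (2 * (A\<^sup>2 + t\<^sup>2)))"
proof -
  define F where "F = (\<lambda>\<xi>::'a. complex_of_real (exp (- A * (norm \<xi>)\<^sup>2)) * cis (t * (norm \<xi>)\<^sup>2) * cis (x \<bullet> \<xi>))"
  define J where "J = (LINT \<xi>|lborel. F \<xi>)"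
  \<comment> \<open>The rate of decay in \<open>u\<close> that remains after integrating out \<eta>:
    \<open>A / 2\<close> from the moduli plus \<open>t\<^sup>2 / (2 * A)\<close> from the quadratic
    phase.\<close>
  define B where "B = (A\<^sup>2 + t\<^sup>2) / (2 * A)"
  have B: "B > 0" using A unfolding B_def by (intro divide_pos_pos add_pos_nonneg) auto
  have Fm[measurable]: "F \<in> borel_measurable borel"
    unfolding F_def by measurable
  have nF: "norm (F \<xi>) = exp (- A * (norm \<xi>)\<^sup>2)" for \<xi>
    by (simp add: F_def norm_mult)
  have Fi: "integrable lborel F"
    by (rule Bochner_Integration.integrable_bound[OF integrable.intros[OF gaussian_integral[OF A, where 'a='a]]])
      (auto simp: nF)
  have Fi': "integrable lborel (\<lambda>u. F (\<eta> + u))" for \<eta>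
    using has_bochner_integral_lborel_translate[of F J \<eta>] Fi by (auto simp: has_bochner_integral_iff J_def)
  have int: "integrable (lborel \<Otimes>\<^sub>M lborel) (\<lambda>(\<eta>, u). cnj (F \<eta>) * F (\<eta> + u))"
  proof (rule lborel_pair.Fubini_integrable)
    show "AE \<eta> in lborel. integrable lborel (\<lambda>u. case (\<eta>, u) of (\<eta>, u) \<Rightarrow> cnj (F \<eta>) * F (\<eta> + u))"
      using Fi' by (intro AE_I2) auto
    have "integrable lborel (\<lambda>\<eta>. norm (F \<eta>) * (LINT u|lborel. norm (F u)))"
      using Fi by simp
    moreover have "(LINT u|lborel. norm (F (\<eta> + u))) = (LINT u|lborel. norm (F u))" for \<eta>
      by (rule integral_lborel_translate) measurable
    ultimately show "integrable lborel (\<lambda>\<eta>. LINT u|lborel. norm (case (\<eta>, u) of (\<eta>, u) \<Rightarrow> cnj (F \<eta>) * F (\<eta> + u)))"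
      by (simp add: norm_mult)
  qed measurable
  have inner: "(LINT \<eta>|lborel. cnj (F \<eta>) * F (\<eta> + u)) = of_real ((pi / (2 * A)) powr (DIM('a) / 2)) *
     (of_real (exp (- B * (norm u)\<^sup>2)) * cis (x \<bullet> u))" for u
  proof -
    have A2: "2 * A > 0" using A by simp
    \<comment> \<open>Shifting \<eta> by \<open>- v\<close> puts the two arguments at
      \<open>\<eta> - v\<close> and \<open>\<eta> + v\<close>. The moduli then have no cross term,
      and the quadratic phases differ by \<open>4 * t * (v \<bullet> \<eta>)\<close>, which is
      linear in \<eta>.\<close>
    define v where "v = u /\<^sub>R 2"
    have u: "u = v + v" by (simp add: v_def flip: scaleR_add_left)
    have eq: "cnj (F (- v + \<eta>)) * F (- v + \<eta> + u) =
       of_real (exp (- A * (norm u)\<^sup>2 / 2)) * cis (x \<bullet> u) * (of_real (exp (- (2 * A) * (norm \<eta>)\<^sup>2)) * cis (((2 * t) *\<^sub>R u) \<bullet> \<eta>))" for \<eta>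
    proof -
      have n1: "(norm (- v + \<eta>))\<^sup>2 = (norm \<eta>)\<^sup>2 - 2 * (v \<bullet> \<eta>) + (norm v)\<^sup>2"
        by (simp add: power2_norm_eq_inner inner_simps inner_commute)
      have n2: "(norm (- v + \<eta> + u))\<^sup>2 = (norm \<eta>)\<^sup>2 + 2 * (v \<bullet> \<eta>) + (norm v)\<^sup>2"
        by (simp add: u power2_norm_eq_inner inner_simps inner_commute)
      have n3: "(norm u)\<^sup>2 = 4 * (norm v)\<^sup>2"
        by (simp add: u power2_norm_eq_inner inner_simps)
      have e: "exp (- A * (norm (- v + \<eta>))\<^sup>2) * exp (- A * (norm (- v + \<eta> + u))\<^sup>2)
         = exp (- A * (norm u)\<^sup>2 / 2) * exp (- (2 * A) * (norm \<eta>)\<^sup>2)"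
        unfolding exp_add [symmetric] n1 n2 n3 by (rule arg_cong[of _ _ exp]) algebra
      have c: "cis (- (t * (norm (- v + \<eta>))\<^sup>2)) * cis (- (x \<bullet> (- v + \<eta>))) * (cis (t * (norm (- v + \<eta> + u))\<^sup>2) * cis (x \<bullet> (- v + \<eta> + u)))
         = cis (x \<bullet> u) * cis (((2 * t) *\<^sub>R u) \<bullet> \<eta>)"
        unfolding cis_mult n1 n2 by (rule arg_cong[of _ _ cis]) (simp add: u inner_simps algebra_simps)
      have "cnj (F (- v + \<eta>)) * F (- v + \<eta> + u) =
        of_real (exp (- A * (norm (- v + \<eta>))\<^sup>2) * exp (- A * (norm (- v + \<eta> + u))\<^sup>2)) *
        (cis (- (t * (norm (- v + \<eta>))\<^sup>2)) * cis (- (x \<bullet> (- v + \<eta>))) * (cis (t * (norm (- v + \<eta> + u))\<^sup>2) * cis (x \<bullet> (- v + \<eta> + u))))"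
        unfolding F_def complex_cnj_mult complex_cnj_complex_of_real cis_cnj of_real_mult by (simp only: mult_ac)
      then show ?thesis
        unfolding e c of_real_mult by (simp only: mult_ac)
    qed
    have "(LINT \<eta>|lborel. cnj (F \<eta>) * F (\<eta> + u)) = (LINT \<eta>|lborel. cnj (F (- v + \<eta>)) * F (- v + \<eta> + u))"
      by (rule integral_lborel_translate [symmetric]) measurable
    also have "\<dots> = of_real (exp (- A * (norm u)\<^sup>2 / 2)) * cis (x \<bullet> u) *
        of_real ((pi / (2 * A)) powr (DIM('a) / 2) * exp (- (norm ((2 * t) *\<^sub>R u))\<^sup>2 / (4 * (2 * A))))"
      unfolding eq integral_mult_right_zero using gaussian_fourier[OF A2, of "(2 * t) *\<^sub>R u"]
      by (simp only: has_bochner_integral_iff)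
    also have "\<dots> = of_real ((pi / (2 * A)) powr (DIM('a) / 2)) *
       (of_real (exp (- A * (norm u)\<^sup>2 / 2) * exp (- (norm ((2 * t) *\<^sub>R u))\<^sup>2 / (4 * (2 * A)))) * cis (x \<bullet> u))"
      by (simp only: of_real_mult mult_ac)
    also have "exp (- A * (norm u)\<^sup>2 / 2) * exp (- (norm ((2 * t) *\<^sub>R u))\<^sup>2 / (4 * (2 * A))) = exp (- B * (norm u)\<^sup>2)"
      unfolding exp_add [symmetric] B_def using A
      by (intro arg_cong[of _ _ exp]) (simp add: power_mult_distrib field_simps power2_eq_square)
    finally show ?thesis .
  qed
  have "complex_of_real ((norm J)\<^sup>2) = cnj J * J"
    by (simp only: complex_norm_square mult.commute)
  \<comment> \<open>By translation invariance the inner integral equals \<open>J\<close> for every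
    \<eta>, so inserting the shift changes nothing.\<close>
  also have "\<dots> = (LINT \<eta>|lborel. cnj (F \<eta>) * (LINT u|lborel. F (\<eta> + u)))"
    unfolding integral_lborel_translate[OF Fm] J_def [symmetric] integral_mult_left_zero
    unfolding J_def by (simp flip: integral_cnj)
  also have "\<dots> = (LINT \<eta>|lborel. (LINT u|lborel. cnj (F \<eta>) * F (\<eta> + u)))"
    by simp
  also have "\<dots> = (LINT u|lborel. (LINT \<eta>|lborel. cnj (F \<eta>) * F (\<eta> + u)))"
    by (rule lborel_pair.Fubini_integral[OF int, symmetric])
  also have "\<dots> = of_real ((pi / (2 * A)) powr (DIM('a) / 2)) * of_real ((pi / B) powr (DIM('a) / 2) * exp (- (norm x)\<^sup>2 / (4 * B)))"
    unfolding inner integral_mult_right_zero using gaussian_fourier[OF B, of x]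
    by (simp only: has_bochner_integral_iff)
  also have "\<dots> = of_real ((pi / (2 * A)) powr (DIM('a) / 2) * (pi / B) powr (DIM('a) / 2) * exp (- (norm x)\<^sup>2 / (4 * B)))"
    by (simp only: of_real_mult mult.assoc)
  also have "(pi / (2 * A)) powr (DIM('a) / 2) * (pi / B) powr (DIM('a) / 2) = (pi\<^sup>2 / (A\<^sup>2 + t\<^sup>2)) powr (DIM('a) / 2)"
    using A B by (subst powr_mult [symmetric]) (auto simp: B_def power2_eq_square)
  also have "- (norm x)\<^sup>2 / (4 * B) = - A * (norm x)\<^sup>2 / (2 * (A\<^sup>2 + t\<^sup>2))"
  proof -
    have "4 * B = 2 * (A\<^sup>2 + t\<^sup>2) / A"
      using A by (simp add: B_def field_simps)
    then show ?thesis
      by (simp add: mult.commute)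
  qed
  finally show ?thesis
    unfolding J_def F_def of_real_eq_iff .
qed

section \<open>The inverse Fourier transform on L2 and the multiplier operator\<close>

text \<open>The difference from the truncated integral is the Fourier integral of the tail of
  \<open>h\<close> outside the ball. Bessel's inequality bounds it by the L2 norm of that tail,
  which tends to 0 by dominated convergence.\<close>

lemma is_inverse_fourier_L2_fourier_integral:
  fixes h :: "'a::euclidean_space \<Rightarrow> complex"
  assumes h: "integrable lborel h" and h2: "integrable lborel (\<lambda>\<xi>. (norm (h \<xi>))\<^sup>2)"
  shows "is_inverse_fourier_L2 h
    (\<lambda>x. complex_of_real (1 / (2 * pi) ^ DIM('a)) * (LINT \<xi>|lborel. h \<xi> * cis (x \<bullet> \<xi>)))"
proof -
  have hm[measurable]: "h \<in> borel_measurable borel"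
    using borel_measurable_integrable[OF h] by simp
  define c where "c = complex_of_real (1 / (2 * pi) ^ DIM('a))"
  define G where "G = (\<lambda>x. c * (LINT \<xi>|lborel. h \<xi> * cis (x \<bullet> \<xi>)))"
  define GR where "GR = (\<lambda>R x. c * (LINT \<xi>:cball 0 R|lborel. h \<xi> * cis (x \<bullet> \<xi>)))"
  define k where "k = (\<lambda>R \<xi>. indicator (- cball 0 R) \<xi> *\<^sub>R h \<xi>)"
  have [measurable]: "k R \<in> borel_measurable borel" for R
    unfolding k_def by measurable
  have k: "integrable lborel (k R)" "integrable lborel (\<lambda>\<xi>. (norm (k R \<xi>))\<^sup>2)" for R
    by (rule Bochner_Integration.integrable_bound[OF h] Bochner_Integration.integrable_bound[OF h2];
        auto simp: k_def split: split_indicator)+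
  have diff: "G x - GR R x = c * (LINT \<xi>|lborel. k R \<xi> * cis (x \<bullet> \<xi>))" for R x
  proof -
    have [measurable]: "(\<lambda>\<xi>. indicator (cball 0 R) \<xi> *\<^sub>R (h \<xi> * cis (x \<bullet> \<xi>))) \<in> borel_measurable borel"
      by (intro borel_measurable_scaleR borel_measurable_indicator) simp_all
    have "integrable lborel (\<lambda>\<xi>. indicator (cball 0 R) \<xi> *\<^sub>R (h \<xi> * cis (x \<bullet> \<xi>)))"
      by (rule Bochner_Integration.integrable_bound[OF h]) (auto simp: norm_mult split: split_indicator)
    then have "(LINT \<xi>|lborel. h \<xi> * cis (x \<bullet> \<xi>)) - (LINT \<xi>:cball 0 R|lborel. h \<xi> * cis (x \<bullet> \<xi>))
       = (LINT \<xi>|lborel. h \<xi> * cis (x \<bullet> \<xi>) - indicator (cball 0 R) \<xi> *\<^sub>R (h \<xi> * cis (x \<bullet> \<xi>)))"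
      unfolding set_lebesgue_integral_def by (simp add: Bochner_Integration.integral_diff integrable_mult_cis[OF h])
    also have "\<dots> = (LINT \<xi>|lborel. k R \<xi> * cis (x \<bullet> \<xi>))"
      by (intro Bochner_Integration.integral_cong) (auto simp: k_def split: split_indicator)
    finally show ?thesis
      by (simp add: G_def GR_def flip: right_diff_distrib)
  qed
  define e where "e = (\<lambda>R. (norm c)\<^sup>2 * ((2 * pi) ^ DIM('a) * (LINT \<xi>|lborel. (norm (k R \<xi>))\<^sup>2)))"
  have upper: "(\<integral>\<^sup>+x. ennreal ((norm (G x - GR R x))\<^sup>2) \<partial>lborel) \<le> ennreal (e R)" for R
  proof -
    have "(\<integral>\<^sup>+x. ennreal ((norm (G x - GR R x))\<^sup>2) \<partial>lborel)
      = ennreal ((norm c)\<^sup>2) * (\<integral>\<^sup>+x. ennreal ((norm (LINT \<xi>|lborel. k R \<xi> * cis (x \<bullet> \<xi>)))\<^sup>2) \<partial>lborel)"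
      unfolding diff by (subst nn_integral_cmult [symmetric]) (auto simp: norm_mult power_mult_distrib ennreal_mult')
    also have "\<dots> \<le> ennreal ((norm c)\<^sup>2) * ennreal ((2 * pi) ^ DIM('a) * (LINT \<xi>|lborel. (norm (k R \<xi>))\<^sup>2))"
      by (intro mult_left_mono fourier_bessel_inequality k) simp
    also have "\<dots> = ennreal (e R)"
      unfolding e_def by (rule ennreal_mult' [symmetric]) simp
    finally show ?thesis .
  qed
  have "((\<lambda>R. LINT \<xi>|lborel. (norm (k R \<xi>))\<^sup>2) \<longlongrightarrow> (LINT \<xi>::'a|lborel. 0)) at_top"
  proof (rule integral_dominated_convergence_at_top[OF _ _ h2])
    show "AE \<xi> in lborel. ((\<lambda>R. (norm (k R \<xi>))\<^sup>2) \<longlongrightarrow> 0) at_top"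
    proof (rule AE_I2, rule tendsto_eventually)
      fix \<xi> :: 'a
      show "\<forall>\<^sub>F R in at_top. (norm (k R \<xi>))\<^sup>2 = 0"
        using eventually_ge_at_top[of "norm \<xi>"] by eventually_elim (auto simp: k_def)
    qed
    show "\<forall>\<^sub>F R in at_top. AE \<xi> in lborel. norm ((norm (k R \<xi>))\<^sup>2) \<le> (norm (h \<xi>))\<^sup>2"
      by (intro always_eventually allI AE_I2) (auto simp: k_def split: split_indicator)
  qed measurable
  then have "(e \<longlongrightarrow> (norm c)\<^sup>2 * ((2 * pi) ^ DIM('a) * 0)) at_top"
    unfolding e_def by (intro tendsto_intros) simp
  then have e0: "((\<lambda>R. ennreal (e R)) \<longlongrightarrow> 0) at_top"
    using tendsto_ennrealI by fastforce
  have "((\<lambda>R. \<integral>\<^sup>+x. ennreal ((norm (G x - GR R x))\<^sup>2) \<partial>lborel) \<longlongrightarrow> 0) at_top"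
    by (rule tendsto_sandwich[OF _ _ tendsto_const e0]) (auto intro!: always_eventually upper)
  then show ?thesis
    using h2 unfolding is_inverse_fourier_L2_def G_def GR_def c_def by simp
qed

text \<open>Both functions are L2 limits of the same truncated integrals, which depend on
  \<open>h\<close> alone.\<close>

lemma is_inverse_fourier_L2_unique:
  assumes g: "is_inverse_fourier_L2 h g" and g': "is_inverse_fourier_L2 h g'"
  shows "AE x in lborel. g x = g' x"
proof -
  define a where "a = (\<lambda>R x. complex_of_real (1 / (2 * pi) ^ DIM('a)) * (LINT \<xi>:cball 0 R|lborel. h \<xi> * cis (x \<bullet> \<xi>)))"
  have [measurable]: "g \<in> borel_measurable borel" "g' \<in> borel_measurable borel" "h \<in> borel_measurable borel"
    using g g' by (auto simp: is_inverse_fourier_L2_def)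
  have [measurable]: "a R \<in> borel_measurable borel" for R
  proof -
    have "(\<lambda>\<xi>. indicator (cball 0 R) \<xi> *\<^sub>R h \<xi>) \<in> borel_measurable borel"
      by (intro borel_measurable_scaleR borel_measurable_indicator) simp_all
    from borel_measurable_fourier_integral[OF this] show ?thesis
      unfolding set_lebesgue_integral_def a_def by simp
  qed
  let ?d = "\<integral>\<^sup>+x. ennreal ((norm (g x - g' x))\<^sup>2) \<partial>lborel"
  \<comment> \<open>The left-hand side does not depend on \<open>R\<close>, while both terms on the
    right tend to 0. The factors 2 come from
    \<open>(a + b)\<^sup>2 \<le> 2 * a\<^sup>2 + 2 * b\<^sup>2\<close>.\<close>
  have le: "?d \<le> 2 * (\<integral>\<^sup>+x. ennreal ((norm (g x - a R x))\<^sup>2) \<partial>lborel) + 2 * (\<integral>\<^sup>+x. ennreal ((norm (g' x - a R x))\<^sup>2) \<partial>lborel)" for R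
  proof -
    have "?d \<le> (\<integral>\<^sup>+x. 2 * ennreal ((norm (g x - a R x))\<^sup>2) + 2 * ennreal ((norm (g' x - a R x))\<^sup>2) \<partial>lborel)"
    proof (rule nn_integral_mono)
      fix x
      have "(norm (g x - g' x))\<^sup>2 \<le> 2 * (norm (g x - z))\<^sup>2 + 2 * (norm (g' x - z))\<^sup>2" for z
      proof -
        have "(norm (g x - g' x))\<^sup>2 \<le> (norm (g x - z) + norm (g' x - z))\<^sup>2"
          using norm_triangle_ineq4[of "g x - z" "g' x - z"] by (intro power_mono) simp_all
        also have "\<dots> \<le> 2 * (norm (g x - z))\<^sup>2 + 2 * (norm (g' x - z))\<^sup>2"
          using sum_squares_bound[of "norm (g x - z)" "norm (g' x - z)"] by (simp add: power2_sum)
        finally show ?thesis .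
      qed
      from ennreal_leI[OF this]
      show "ennreal ((norm (g x - g' x))\<^sup>2) \<le> 2 * ennreal ((norm (g x - a R x))\<^sup>2) + 2 * ennreal ((norm (g' x - a R x))\<^sup>2)"
        by (simp add: ennreal_mult')
    qed
    also have "\<dots> = 2 * (\<integral>\<^sup>+x. ennreal ((norm (g x - a R x))\<^sup>2) \<partial>lborel) + 2 * (\<integral>\<^sup>+x. ennreal ((norm (g' x - a R x))\<^sup>2) \<partial>lborel)"
      by (subst nn_integral_add) (auto simp: nn_integral_cmult)
    finally show ?thesis .
  qed
  have "((\<lambda>R. 2 * (\<integral>\<^sup>+x. ennreal ((norm (g x - a R x))\<^sup>2) \<partial>lborel) + 2 * (\<integral>\<^sup>+x. ennreal ((norm (g' x - a R x))\<^sup>2) \<partial>lborel))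
      \<longlongrightarrow> 2 * 0 + 2 * 0) at_top"
    using g g' unfolding is_inverse_fourier_L2_def a_def
    by (intro tendsto_add ennreal_tendsto_cmult) auto
  then have "?d \<le> 2 * 0 + 2 * 0"
    by (rule tendsto_lowerbound) (auto intro: le always_eventually)
  then have "?d = 0" by simp
  then have "AE x in lborel. ennreal ((norm (g x - g' x))\<^sup>2) = 0"
    by (subst (asm) nn_integral_0_iff_AE) auto
  then show ?thesis
    by eventually_elim simp
qed

text \<open>The explicit integral is an admissible value, so the choice operator picks a function
  with the defining property, and uniqueness identifies the two almost everywhere.\<close>

lemma fourier_multiplier_AE_eq:
  fixes f m :: "'a::euclidean_space \<Rightarrow> complex"
  defines "h \<equiv> \<lambda>\<xi>. m \<xi> * fourier_transform f \<xi>"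
  assumes h: "integrable lborel h" and h2: "integrable lborel (\<lambda>\<xi>. (norm (h \<xi>))\<^sup>2)"
  shows "fourier_multiplier m f \<in> borel_measurable borel"
    and "AE x in lborel. fourier_multiplier m f x =
      complex_of_real (1 / (2 * pi) ^ DIM('a)) * (LINT \<xi>|lborel. h \<xi> * cis (x \<bullet> \<xi>))"
proof -
  have *: "is_inverse_fourier_L2 h (fourier_multiplier m f)"
    unfolding fourier_multiplier_def h_def [symmetric]
    by (rule someI[of "is_inverse_fourier_L2 h", OF is_inverse_fourier_L2_fourier_integral[OF h h2]])
  then show "fourier_multiplier m f \<in> borel_measurable borel"
    by (simp add: is_inverse_fourier_L2_def)
  show "AE x in lborel. fourier_multiplier m f x =
      complex_of_real (1 / (2 * pi) ^ DIM('a)) * (LINT \<xi>|lborel. h \<xi> * cis (x \<bullet> \<xi>))"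
    by (rule is_inverse_fourier_L2_unique[OF * is_inverse_fourier_L2_fourier_integral[OF h h2]])
qed

section \<open>Elementary estimates for the symbol and for superlevel sets\<close>

text \<open>Write the power as \<open>exp (- p * ln (1 + r))\<close> and use
  \<open>exp y \<ge> 1 + y\<close> and \<open>ln (1 + r) \<le> r\<close>. It measures how close the
  symbol's decaying factor is to 1 at low frequency.\<close>

lemma one_minus_powr_le:
  fixes p r :: real
  assumes "p \<ge> 0" "r \<ge> 0"
  shows "0 \<le> 1 - (1 + r) powr (- p)" "1 - (1 + r) powr (- p) \<le> p * r"
proof -
  have "(1 + r) powr (- p) \<le> (1 + r) powr 0"
    using assms by (intro powr_mono) auto
  then show "0 \<le> 1 - (1 + r) powr (- p)" using assms by simp
  have "p * ln (1 + r) \<le> p * r"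
    using assms by (intro mult_left_mono ln_add_one_self_le_self) auto
  then have "1 - p * r \<le> 1 + (- p * ln (1 + r))" by simp
  also have "\<dots> \<le> exp (- p * ln (1 + r))" by (rule exp_ge_add_one_self)
  also have "\<dots> = (1 + r) powr (- p)" using assms by (simp add: powr_def)
  finally show "1 - (1 + r) powr (- p) \<le> p * r" by simp
qed

lemma L2_chebyshev:
  fixes E :: "'a \<Rightarrow> complex"
  assumes [measurable]: "E \<in> borel_measurable M" and l: "l > 0"
    and e: "(\<integral>\<^sup>+x. ennreal ((norm (E x))\<^sup>2) \<partial>M) \<le> ennreal e"
  shows "emeasure M {x \<in> space M. norm (E x) \<ge> l} \<le> ennreal (e / l\<^sup>2)"
proof -
  let ?T = "{x \<in> space M. norm (E x) \<ge> l}"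
  have "emeasure M ?T = ennreal (1 / l\<^sup>2) * (ennreal (l\<^sup>2) * emeasure M ?T)"
    using l by (simp add: mult.assoc [symmetric] flip: ennreal_mult')
  also have "ennreal (l\<^sup>2) * emeasure M ?T = (\<integral>\<^sup>+x. ennreal (l\<^sup>2) * indicator ?T x \<partial>M)"
    by (rule nn_integral_cmult_indicator [symmetric]) measurable
  also have "\<dots> \<le> (\<integral>\<^sup>+x. ennreal ((norm (E x))\<^sup>2) \<partial>M)"
    using l by (intro nn_integral_mono) (auto intro!: ennreal_leI power_mono split: split_indicator)
  also have "\<dots> \<le> ennreal e" by (rule e)
  finally have "emeasure M ?T \<le> ennreal (1 / l\<^sup>2) * ennreal e"
    by (simp add: mult_left_mono)
  then show ?thesis using l by (simp flip: ennreal_mult')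
qed

text \<open>On \<open>S\<close> the sum can fail to exceed \<open>l\<close> only where the
  perturbation \<open>E\<close> has norm at least \<open>l\<close>; by Chebyshev that set has
  measure at most \<open>e / l\<^sup>2\<close>, hence at most \<open>v / 2\<close>.\<close>

lemma emeasure_superlevel_perturbation:
  fixes g E :: "'a \<Rightarrow> complex"
  assumes [measurable]: "g \<in> borel_measurable M" "E \<in> borel_measurable M" "S \<in> sets M"
    and l: "l > 0" and g: "\<And>x. x \<in> S \<Longrightarrow> norm (g x) \<ge> 2 * l"
    and e: "(\<integral>\<^sup>+x. ennreal ((norm (E x))\<^sup>2) \<partial>M) \<le> ennreal e"
    and S: "emeasure M S = ennreal v" and ev: "e \<le> l\<^sup>2 * v / 2" and v: "v \<ge> 0"
  shows "ennreal (v / 2) \<le> emeasure M {x \<in> space M. norm (g x + E x) > l}"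
proof -
  let ?T = "{x \<in> space M. norm (E x) \<ge> l}" and ?U = "{x \<in> space M. norm (g x + E x) > l}"
  have "S \<subseteq> ?U \<union> ?T"
  proof
    fix x assume x: "x \<in> S"
    then have "x \<in> space M" using sets.sets_into_space[OF \<open>S \<in> sets M\<close>] by auto
    moreover have "norm (g x) - norm (E x) \<le> norm (g x + E x)"
      using norm_triangle_ineq4[of "g x + E x" "E x"] by simp
    ultimately show "x \<in> ?U \<union> ?T" using g[OF x] by auto
  qed
  then have "ennreal v \<le> emeasure M (?U \<union> ?T)"
    unfolding S [symmetric] by (intro emeasure_mono) measurable
  also have "\<dots> \<le> emeasure M ?U + emeasure M ?T"
    by (intro emeasure_subadditive) measurable
  also have "emeasure M ?T \<le> ennreal (e / l\<^sup>2)"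
    by (rule L2_chebyshev[OF _ l e]) measurable
  also have "\<dots> \<le> ennreal (v / 2)"
    using l ev by (intro ennreal_leI) (simp add: field_simps)
  finally have "ennreal v \<le> emeasure M ?U + ennreal (v / 2)"
    by (simp add: add_left_mono)
  \<comment> \<open>The superlevel set may have infinite measure, so this case is separated before
    \<open>v / 2\<close> is subtracted.\<close>
  then show ?thesis
    using v by (cases "emeasure M ?U") (auto simp flip: ennreal_plus)
qed

section \<open>The test function and the error in its symbol\<close>

text \<open>This \<open>f\<close> is the heat kernel at time \<open>A\<close>.\<close>

lemma normalized_gaussian:
  fixes A :: real
  assumes A: "A > 0"
  defines "f \<equiv> \<lambda>x::'a::euclidean_space. complex_of_real ((4 * pi * A) powr - (DIM('a) / 2) * exp (- (1 / (4 * A)) * (norm x)\<^sup>2))"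
  shows "integrable lborel f" "(LINT x|lborel. norm (f x)) = 1"
    "fourier_transform f = (\<lambda>\<xi>. complex_of_real (exp (- A * (norm \<xi>)\<^sup>2)))"
proof -
  define c where "c = (4 * pi * A) powr - (DIM('a) / 2)"
  define a where "a = 1 / (4 * A)"
  have a: "a > 0" using A by (simp add: a_def)
  have pa: "pi / a = 4 * pi * A" using A by (simp add: a_def)
  have c: "c * (pi / a) powr (DIM('a) / 2) = 1" "c > 0"
    using A unfolding pa by (simp_all add: c_def powr_minus)
  have f: "f = (\<lambda>x. complex_of_real (c * exp (- a * (norm x)\<^sup>2)))"
    by (simp only: f_def c_def a_def)
  note gi = gaussian_integral[OF a, where 'a='a, unfolded has_bochner_integral_iff]
  have "integrable lborel (\<lambda>x::'a. c * exp (- a * (norm x)\<^sup>2))"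
    using gi by (intro integrable_mult_right) auto
  then show "integrable lborel f"
    unfolding f by (rule integrable_of_real)
  have "(LINT x|lborel. norm (f x)) = (LINT x::'a|lborel. c * exp (- a * (norm x)\<^sup>2))"
    using c(2) by (simp add: f norm_mult abs_of_pos)
  also have "\<dots> = c * (pi / a) powr (DIM('a) / 2)"
    using gi by simp
  finally show "(LINT x|lborel. norm (f x)) = 1"
    by (simp only: c)
  show "fourier_transform f = (\<lambda>\<xi>. complex_of_real (exp (- A * (norm \<xi>)\<^sup>2)))"
  proof
    fix \<xi> :: 'a
    have "fourier_transform f \<xi> = (LINT x|lborel. complex_of_real c * (complex_of_real (exp (- a * (norm x)\<^sup>2)) * cis (- \<xi> \<bullet> x)))"
      by (simp add: fourier_transform_def f mult.assoc inner_commute)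
    also have "\<dots> = complex_of_real c * complex_of_real ((pi / a) powr (DIM('a) / 2) * exp (- (norm (- \<xi>))\<^sup>2 / (4 * a)))"
      using gaussian_fourier[OF a, of "- \<xi>"] by (simp only: integral_mult_right_zero has_bochner_integral_iff)
    also have "\<dots> = complex_of_real (c * (pi / a) powr (DIM('a) / 2) * exp (- (norm (- \<xi>))\<^sup>2 / (4 * a)))"
      by (simp only: of_real_mult mult.assoc)
    also have "\<dots> = complex_of_real (exp (- A * (norm \<xi>)\<^sup>2))"
      using A unfolding c by (simp add: a_def)
    finally show "fourier_transform f \<xi> = complex_of_real (exp (- A * (norm \<xi>)\<^sup>2))" .
  qed
qed

text \<open>The factor \<open>(1 + |\<xi>|\<^sup>2) powr (- n / 2)\<close> deviates from 1 by at
  most \<open>n / 2 * |\<xi>|\<^sup>2\<close>, and the Gaussian confines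
  \<open>|\<xi>|\<^sup>2\<close> to size \<open>1 / A\<close>. The resulting gain
  \<open>(n / A)\<^sup>2\<close> makes the error small relative to the main term once
  \<open>A\<close> is large, uniformly in \<open>t\<close>.\<close>

lemma gaussian_symbol_error_L2:
  fixes A t :: real
  assumes A: "A > 0"
  defines "h \<equiv> \<lambda>\<xi>::'a::euclidean_space. schroedinger_symbol t \<xi> * complex_of_real (exp (- A * (norm \<xi>)\<^sup>2))"
    and "g \<equiv> \<lambda>\<xi>::'a. complex_of_real (exp (- A * (norm \<xi>)\<^sup>2)) * cis (t * (norm \<xi>)\<^sup>2)"
  shows "integrable lborel g" "integrable lborel h" "integrable lborel (\<lambda>\<xi>. (norm (h \<xi>))\<^sup>2)"
    "integrable lborel (\<lambda>\<xi>. (norm (h \<xi> - g \<xi>))\<^sup>2)"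
    "(LINT \<xi>|lborel. (norm (h \<xi> - g \<xi>))\<^sup>2) \<le> (DIM('a) / A)\<^sup>2 * (pi / A) powr (DIM('a) / 2)"
proof -
  define p where "p = (\<lambda>\<xi>::'a. (1 + (norm \<xi>)\<^sup>2) powr (- (real DIM('a) / 2)))"
  have [measurable]: "p \<in> borel_measurable borel" unfolding p_def by measurable
  have hg: "h = (\<lambda>\<xi>. complex_of_real (p \<xi>) * g \<xi>)"
    by (auto simp: h_def g_def p_def schroedinger_symbol_def)
  have [measurable]: "g \<in> borel_measurable borel" unfolding g_def by measurable
  have [measurable]: "h \<in> borel_measurable borel" unfolding hg by measurable
  have p: "0 \<le> p \<xi>" "p \<xi> \<le> 1" "1 - p \<xi> \<le> DIM('a) / 2 * (norm \<xi>)\<^sup>2" for \<xi>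
    using one_minus_powr_le[of "DIM('a) / 2" "(norm \<xi>)\<^sup>2"] by (auto simp: p_def)
  have ng: "norm (g \<xi>) = exp (- A * (norm \<xi>)\<^sup>2)" for \<xi>
    by (simp add: g_def norm_mult)
  have nh: "norm (h \<xi>) \<le> exp (- A * (norm \<xi>)\<^sup>2)" for \<xi>
    using p[of \<xi>] by (simp add: hg norm_mult ng mult_left_le_one_le)
  have gi: "integrable lborel (\<lambda>\<xi>::'a. exp (- A * (norm \<xi>)\<^sup>2))"
      "(LINT \<xi>::'a|lborel. exp (- A * (norm \<xi>)\<^sup>2)) = (pi / A) powr (DIM('a) / 2)"
    using gaussian_integral[OF A, where 'a='a] by (auto simp: has_bochner_integral_iff)
  show "integrable lborel g"
    by (rule Bochner_Integration.integrable_bound[OF gi(1)]) (auto simp: ng)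
  show "integrable lborel h"
    by (rule Bochner_Integration.integrable_bound[OF gi(1)]) (use nh in auto)
  have "(norm (h \<xi>))\<^sup>2 \<le> exp (- A * (norm \<xi>)\<^sup>2)" for \<xi>
  proof -
    have "(norm (h \<xi>))\<^sup>2 \<le> (exp (- A * (norm \<xi>)\<^sup>2))\<^sup>2"
      by (intro power_mono nh) simp
    also have "\<dots> \<le> exp (- A * (norm \<xi>)\<^sup>2)"
      using A by (simp add: power2_eq_square mult_le_cancel_left1)
    finally show ?thesis .
  qed
  then show "integrable lborel (\<lambda>\<xi>. (norm (h \<xi>))\<^sup>2)"
    by (intro Bochner_Integration.integrable_bound[OF gi(1)]) auto
  have k: "(norm (h \<xi> - g \<xi>))\<^sup>2 \<le> (DIM('a) / A)\<^sup>2 * exp (- A * (norm \<xi>)\<^sup>2)" for \<xi>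
  proof -
    define r where "r = (norm \<xi>)\<^sup>2"
    have r: "r \<ge> 0" by (simp add: r_def)
    have "h \<xi> - g \<xi> = - complex_of_real (1 - p \<xi>) * g \<xi>"
      by (simp add: hg algebra_simps)
    then have "norm (h \<xi> - g \<xi>) = (1 - p \<xi>) * exp (- A * r)"
      using p(2)[of \<xi>] by (simp add: norm_mult ng r_def del: of_real_diff)
    also have "\<dots> \<le> DIM('a) / 2 * r * exp (- A * r)"
      using p(3)[of \<xi>] by (intro mult_right_mono) (auto simp: r_def)
    \<comment> \<open>One half of the exponential absorbs \<open>r\<close>, by
      \<open>y \<le> 2 * exp (y / 2)\<close> at \<open>y = A * r\<close>; the other half gives
      \<open>exp (- A * r)\<close> again after squaring.\<close>
    also have "\<dots> = DIM('a) / 2 * (r * exp (- A * r / 2)) * exp (- A * r / 2)"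
      by (simp add: mult.assoc flip: exp_add)
    also have "\<dots> \<le> DIM('a) / 2 * (2 / A) * exp (- A * r / 2)"
    proof (intro mult_right_mono mult_left_mono)
      have "1 + A * r / 2 \<le> exp (A * r / 2)"
        by (rule exp_ge_add_one_self)
      then have "A * r \<le> 2 * exp (A * r / 2)" by linarith
      with A show "r * exp (- A * r / 2) \<le> 2 / A"
        by (simp add: exp_minus field_simps)
    qed auto
    finally have "norm (h \<xi> - g \<xi>) \<le> DIM('a) / A * exp (- A * r / 2)" by simp
    then have "(norm (h \<xi> - g \<xi>))\<^sup>2 \<le> (DIM('a) / A * exp (- A * r / 2))\<^sup>2"
      by (rule power_mono) simp
    also have "\<dots> = (DIM('a) / A)\<^sup>2 * exp (- A * r)"
      unfolding power_mult_distrib by (simp add: power2_eq_square flip: exp_add)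
    finally show ?thesis by (simp add: r_def)
  qed
  have ki: "integrable lborel (\<lambda>\<xi>::'a. (DIM('a) / A)\<^sup>2 * exp (- A * (norm \<xi>)\<^sup>2))"
    using gi(1) by (intro integrable_mult_right)
  show i: "integrable lborel (\<lambda>\<xi>. (norm (h \<xi> - g \<xi>))\<^sup>2)"
    by (rule Bochner_Integration.integrable_bound[OF ki]) (use k in auto)
  have "(LINT \<xi>|lborel. (norm (h \<xi> - g \<xi>))\<^sup>2) \<le> (LINT \<xi>::'a|lborel. (DIM('a) / A)\<^sup>2 * exp (- A * (norm \<xi>)\<^sup>2))"
    by (rule integral_mono[OF i ki k])
  then show "(LINT \<xi>|lborel. (norm (h \<xi> - g \<xi>))\<^sup>2) \<le> (DIM('a) / A)\<^sup>2 * (pi / A) powr (DIM('a) / 2)"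
    by (simp only: integral_mult_right_zero gi(2))
qed

section \<open>The lower bound for the operator norm\<close>

lemma schroedinger_weak_L1_lower_bound:
  "\<exists>C>0. \<forall>t\<ge>1.
    L1_weak_L1_opnorm (fourier_multiplier (schroedinger_symbol t :: 'a::euclidean_space \<Rightarrow> complex))
      \<ge> ennreal (C * t powr (real DIM('a) / 2))"
proof -
  define n where "n = real DIM('a)"
  define s where "s = (4 * pi) powr (n / 2)"
  define \<omega> where "\<omega> = unit_ball_vol n"
  \<comment> \<open>Chosen so that the error bound \<open>(n / A)\<^sup>2 / (s * \<alpha>)\<close>
    equals half of \<open>l\<^sup>2\<close> times the volume of the ball of radius \<open>R\<close>.
    In that product \<delta> cancels, which is why \<open>A\<close> can be independent of
    \<open>t\<close>.\<close>
  define A where "A = sqrt (32 * n\<^sup>2 * s / \<omega>)"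
  define \<alpha> where "\<alpha> = A powr (n / 2)"
  have n: "n > 0" by (simp add: n_def)
  have s: "s > 0" by (simp add: s_def)
  have \<omega>: "\<omega> > 0" using n by (simp add: \<omega>_def)
  have A: "A > 0" using n s \<omega> by (simp add: A_def)
  have A2: "A\<^sup>2 = 32 * n\<^sup>2 * s / \<omega>" using n s \<omega> by (simp add: A_def)
  have \<alpha>: "\<alpha> > 0" using A by (simp add: \<alpha>_def)
  \<comment> \<open>The level \<open>l = 1 / (4 * s * \<delta>)\<close> times half the volume
    \<open>\<omega> * \<delta>\<^sup>2 / \<alpha>\<close> of the ball is
    \<open>C * \<delta>\<close>.\<close>
  define C where "C = \<omega> / (8 * s * \<alpha>)"
  have "C > 0" using \<omega> s \<alpha> by (simp add: C_def)
  moreover have "ennreal (C * t powr (real DIM('a) / 2)) \<le>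
      L1_weak_L1_opnorm (fourier_multiplier (schroedinger_symbol t :: 'a \<Rightarrow> complex))" if t: "t \<ge> 1" for t
  proof -
    define D where "D = sqrt (A\<^sup>2 + t\<^sup>2)"
    have D2: "D\<^sup>2 = A\<^sup>2 + t\<^sup>2" by (simp add: D_def)
    have "A\<^sup>2 + t\<^sup>2 > 0" using A by (simp add: add_pos_nonneg)
    then have D: "D > 0" by (simp add: D_def)
    have tD: "t \<le> D" unfolding D_def by (rule real_le_rsqrt) simp
    define \<delta> where "\<delta> = D powr (n / 2)"
    have \<delta>: "\<delta> > 0" using D by (simp add: \<delta>_def)
    \<comment> \<open>On the ball of this radius the exponent
      \<open>A * (norm x)\<^sup>2 / (2 * D\<^sup>2)\<close> of the squared modulus of
      \<open>P\<close> is at most \<open>1 / 2\<close>.\<close>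
    define R where "R = D / sqrt A"
    have R: "R > 0" "R\<^sup>2 = D\<^sup>2 / A" using A D by (auto simp: R_def power_divide)
    have Rn: "R ^ DIM('a) = \<delta>\<^sup>2 / \<alpha>"
    proof -
      have "R ^ DIM('a) = R powr n"
        using R by (simp add: n_def powr_realpow)
      also have "\<dots> = (R\<^sup>2) powr (n / 2)"
        using R(1) by (simp add: powr_powr flip: powr_numeral)
      also have "\<dots> = (D\<^sup>2) powr (n / 2) / \<alpha>"
        unfolding R(2) \<alpha>_def by (rule powr_divide)
      also have "(D\<^sup>2) powr (n / 2) = \<delta>\<^sup>2"
        using D by (simp add: \<delta>_def powr_power powr_powr flip: powr_numeral)
      finally show ?thesis .
    qed
    define c where "c = 1 / (2 * pi) ^ DIM('a)"
    have c: "c > 0" by (simp add: c_def)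
    have c_eq: "c = 1 / (s * pi powr (n / 2))"
    proof -
      have "s * pi powr (n / 2) = ((2 * pi) powr 2) powr (n / 2)"
        unfolding s_def by (subst powr_mult [symmetric]) (simp add: power2_eq_square mult_ac)
      also have "\<dots> = (2 * pi) ^ DIM('a)"
        unfolding powr_powr by (simp add: n_def powr_realpow)
      finally show ?thesis by (simp only: c_def)
    qed
    \<comment> \<open>A quarter of \<open>norm (P 0)\<close>: one factor 2 is lost to the decay of
      \<open>P\<close> on the ball, another to the perturbation \<open>E\<close>.\<close>
    define l where "l = 1 / (4 * s * \<delta>)"
    have l: "l > 0" using s \<delta> by (simp add: l_def)
    define f where "f = (\<lambda>x::'a. complex_of_real ((4 * pi * A) powr - (DIM('a) / 2) * exp (- (1 / (4 * A)) * (norm x)\<^sup>2)))"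
    have f: "integrable lborel f" "(LINT x|lborel. norm (f x)) = 1"
        "fourier_transform f = (\<lambda>\<xi>. complex_of_real (exp (- A * (norm \<xi>)\<^sup>2)))"
      unfolding f_def by (rule normalized_gaussian[OF A])+
    define h where "h = (\<lambda>\<xi>::'a. schroedinger_symbol t \<xi> * complex_of_real (exp (- A * (norm \<xi>)\<^sup>2)))"
    define g where "g = (\<lambda>\<xi>::'a. complex_of_real (exp (- A * (norm \<xi>)\<^sup>2)) * cis (t * (norm \<xi>)\<^sup>2))"
    have hg: "integrable lborel g" "integrable lborel h" "integrable lborel (\<lambda>\<xi>. (norm (h \<xi>))\<^sup>2)"
        "integrable lborel (\<lambda>\<xi>. (norm (h \<xi> - g \<xi>))\<^sup>2)"
        "(LINT \<xi>|lborel. (norm (h \<xi> - g \<xi>))\<^sup>2) \<le> (n / A)\<^sup>2 * (pi / A) powr (n / 2)"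
      unfolding h_def g_def n_def by (rule gaussian_symbol_error_L2[OF A])+
    have [measurable]: "h \<in> borel_measurable borel" "g \<in> borel_measurable borel"
      using hg(1,2)[THEN borel_measurable_integrable] by simp_all
    define Tf where "Tf = fourier_multiplier (schroedinger_symbol t) f"
    define P where "P = (\<lambda>x::'a. complex_of_real c * (LINT \<xi>|lborel. g \<xi> * cis (x \<bullet> \<xi>)))"
    define E where "E = (\<lambda>x::'a. complex_of_real c * (LINT \<xi>|lborel. (h \<xi> - g \<xi>) * cis (x \<bullet> \<xi>)))"
    have [measurable]: "P \<in> borel_measurable borel" "E \<in> borel_measurable borel"
      unfolding P_def E_def by measurable
    have Tm[measurable]: "Tf \<in> borel_measurable borel"
      and TfG: "AE x in lborel. Tf x = complex_of_real c * (LINT \<xi>|lborel. h \<xi> * cis (x \<bullet> \<xi>))"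
      using fourier_multiplier_AE_eq[of "schroedinger_symbol t" f] hg(2,3)
      unfolding f(3) Tf_def c_def h_def by auto
    have PE: "complex_of_real c * (LINT \<xi>|lborel. h \<xi> * cis (x \<bullet> \<xi>)) = P x + E x" for x
      unfolding P_def E_def left_diff_distrib
      by (subst Bochner_Integration.integral_diff) (auto intro: integrable_mult_cis hg simp: algebra_simps)
    have TfE: "AE x in lborel. Tf x = P x + E x"
      using TfG by eventually_elim (simp only: PE)
    have P_lower: "norm (P x) \<ge> 2 * l" if x: "x \<in> cball 0 R" for x
    proof -
      have "(norm (P x))\<^sup>2 = c\<^sup>2 * ((pi\<^sup>2 / D\<^sup>2) powr (n / 2) * exp (- A * (norm x)\<^sup>2 / (2 * D\<^sup>2)))"
        using c complex_gaussian_fourier_norm[OF A, of t x]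
        unfolding P_def g_def D2 n_def by (simp add: norm_mult power_mult_distrib)
      also have "\<dots> = c\<^sup>2 * (pi\<^sup>2 / D\<^sup>2) powr (n / 2) * exp (- A * (norm x)\<^sup>2 / (2 * D\<^sup>2))"
        by (simp only: mult.assoc)
      also have "c\<^sup>2 * (pi\<^sup>2 / D\<^sup>2) powr (n / 2) = (4 * l)\<^sup>2"
      proof -
        have a: "(pi\<^sup>2 / D\<^sup>2) powr (n / 2) = (pi powr (n / 2) / \<delta>)\<^sup>2"
          using D by (simp add: power_divide powr_divide \<delta>_def powr_power powr_powr flip: powr_numeral)
        show ?thesis
          using s \<delta> unfolding c_eq a l_def power_mult_distrib [symmetric] by (simp add: field_simps)
      qed
      \<comment> \<open>The argument gives \<open>1 / 2\<close>; the cruder \<open>1 / 4\<close> is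
        a perfect square and turns \<open>4 * l\<close> into \<open>2 * l\<close> on taking
        roots.\<close>
      also have "exp (- A * (norm x)\<^sup>2 / (2 * D\<^sup>2)) \<ge> 1 / 4"
      proof -
        have "(norm x)\<^sup>2 \<le> R\<^sup>2" using x by (intro power_mono) auto
        then have "A * (norm x)\<^sup>2 \<le> D\<^sup>2" using A unfolding R by (simp add: field_simps)
        then have "A * (norm x)\<^sup>2 / (2 * D\<^sup>2) \<le> 1 / 2" using D by (simp add: field_simps)
        moreover have "1 + - A * (norm x)\<^sup>2 / (2 * D\<^sup>2) \<le> exp (- A * (norm x)\<^sup>2 / (2 * D\<^sup>2))"
          by (rule exp_ge_add_one_self)
        ultimately show ?thesis by simp
      qed
      then have "(4 * l)\<^sup>2 * exp (- A * (norm x)\<^sup>2 / (2 * D\<^sup>2)) \<ge> (4 * l)\<^sup>2 * (1 / 4)"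
        by (intro mult_left_mono) auto
      finally have "(2 * l)\<^sup>2 \<le> (norm (P x))\<^sup>2" by (simp add: power2_eq_square)
      then show ?thesis by (rule power2_le_imp_le) simp
    qed
    have E_upper: "(\<integral>\<^sup>+x. ennreal ((norm (E x))\<^sup>2) \<partial>lborel) \<le> ennreal ((n / A)\<^sup>2 / (s * \<alpha>))"
    proof -
      have "(\<integral>\<^sup>+x. ennreal ((norm (E x))\<^sup>2) \<partial>lborel) =
          ennreal (c\<^sup>2) * (\<integral>\<^sup>+x. ennreal ((norm (LINT \<xi>|lborel. (h \<xi> - g \<xi>) * cis (x \<bullet> \<xi>)))\<^sup>2) \<partial>lborel)"
        by (subst nn_integral_cmult [symmetric]) (auto simp: E_def norm_mult power_mult_distrib ennreal_mult')
      also have "\<dots> \<le> ennreal (c\<^sup>2) * ennreal ((2 * pi) ^ DIM('a) * (LINT \<xi>|lborel. (norm (h \<xi> - g \<xi>))\<^sup>2))"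
        using hg by (intro mult_left_mono fourier_bessel_inequality) auto
      \<comment> \<open>Since \<open>c\<close> is the reciprocal of
        \<open>(2 * pi) ^ DIM('a)\<close>, one of its two factors cancels the constant in Bessel's
        inequality.\<close>
      also have "\<dots> = ennreal (c * (LINT \<xi>|lborel. (norm (h \<xi> - g \<xi>))\<^sup>2))"
        by (subst ennreal_mult' [symmetric]) (auto simp: c_def power2_eq_square)
      also have "\<dots> \<le> ennreal (c * ((n / A)\<^sup>2 * (pi / A) powr (n / 2)))"
        using hg(5) c by (intro ennreal_leI mult_left_mono) auto
      also have "c * ((n / A)\<^sup>2 * (pi / A) powr (n / 2)) = (n / A)\<^sup>2 / (s * \<alpha>)"
      proof -
        have "(pi / A) powr (n / 2) = pi powr (n / 2) / \<alpha>"
          unfolding \<alpha>_def by (rule powr_divide)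
        then show ?thesis by (simp add: c_eq)
      qed
      finally show ?thesis .
    qed
    have ball: "emeasure lborel (cball (0::'a) R) = ennreal (\<omega> * (\<delta>\<^sup>2 / \<alpha>))"
      using R by (simp add: emeasure_cball Rn \<omega>_def n_def)
    have "ennreal (\<omega> * (\<delta>\<^sup>2 / \<alpha>) / 2) \<le> emeasure lborel {x \<in> space lborel. norm (P x + E x) > l}"
    proof (rule emeasure_superlevel_perturbation[OF _ _ _ l P_lower E_upper ball])
      have "(n / A)\<^sup>2 / (s * \<alpha>) = \<omega> / (32 * s\<^sup>2 * \<alpha>)"
        unfolding power_divide A2 using n s \<omega> by (simp add: field_simps power2_eq_square)
      also have "\<dots> = l\<^sup>2 * (\<omega> * (\<delta>\<^sup>2 / \<alpha>)) / 2"
        unfolding l_def using s \<delta> \<alpha> by (simp add: field_simps power2_eq_square)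
      finally show "(n / A)\<^sup>2 / (s * \<alpha>) \<le> l\<^sup>2 * (\<omega> * (\<delta>\<^sup>2 / \<alpha>)) / 2" by simp
    qed (use \<omega> \<delta> \<alpha> in auto)
    \<comment> \<open>\<open>Tf\<close> is determined only up to null sets, which do not affect the
      measure of a superlevel set.\<close>
    also have "\<dots> = emeasure lborel {x. norm (Tf x) > l}"
      by (rule emeasure_eq_AE) (use TfE in \<open>auto elim: eventually_mono\<close>)
    finally have level: "ennreal (\<omega> * (\<delta>\<^sup>2 / \<alpha>) / 2) \<le> emeasure lborel {x. norm (Tf x) > l}" .
    \<comment> \<open>Only here is \<open>D\<close> compared with \<open>t\<close>: the bound
      obtained is \<open>C * D powr (n / 2)\<close>, and \<open>t \<le> D\<close>.\<close>
    have "C * t powr (n / 2) \<le> C * \<delta>"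
      unfolding \<delta>_def using \<open>C > 0\<close> t tD n by (intro mult_left_mono powr_mono2) auto
    also have "\<dots> = l * (\<omega> * (\<delta>\<^sup>2 / \<alpha>) / 2)"
      unfolding C_def l_def using s \<delta> \<alpha> by (simp add: field_simps power2_eq_square)
    finally have "ennreal (C * t powr (n / 2)) \<le> ennreal (l * (\<omega> * (\<delta>\<^sup>2 / \<alpha>) / 2))"
      by (rule ennreal_leI)
    also have "\<dots> = ennreal l * ennreal (\<omega> * (\<delta>\<^sup>2 / \<alpha>) / 2)"
      using l by (intro ennreal_mult') simp
    also have "\<dots> \<le> ennreal l * emeasure lborel {x. norm (Tf x) > l}"
      by (intro mult_left_mono level) simp
    also have "\<dots> \<le> weak_L1_norm Tf"
      unfolding weak_L1_norm_def using l by (intro SUP_upper) simp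
    also have "\<dots> \<le> L1_weak_L1_opnorm (fourier_multiplier (schroedinger_symbol t :: 'a \<Rightarrow> complex))"
      unfolding L1_weak_L1_opnorm_def Tf_def using f(1,2) by (intro SUP_upper) simp
    finally show ?thesis unfolding n_def .
  qed
  ultimately show ?thesis by blast
qed

theorem proposition3p3:
  shows "\<exists>C>0. \<forall>t\<ge>1.
    L1_weak_L1_opnorm (fourier_multiplier (schroedinger_symbol t :: real ^ 'n \<Rightarrow> complex))
      \<ge> ennreal (C * t powr (real CARD('n) / 2))"
  using schroedinger_weak_L1_lower_bound[where 'a="real ^ 'n"] by simp

end
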